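(* Let $p(\cdot)\in\mathcal{P}(\mathbb{R})$ satisfy at least one of: $p_+<\infty$; or $1/p(\cdot)$ is log-Hölder continuous at infinity with limit $1$ (i.e. there is $C>0$ with $\left|\frac{1}{p(x)}-1\right|\le \frac{C}{\log(e+|x|)}$ for almost every $x\in\mathbb{R}$). For $f\in L^{p(\cdot)}(\mathbb{R})$, the Fourier transform $\widehat f:=\Psi_f'$ (distributional derivative) agrees with the Fourier transform of $f$ as a tempered distribution; that is, for every $\varphi\in\mathcal{S}(\mathbb{R})$, $$\langle\widehat{f},\varphi\rangle=-\int_{-\infty}^\infty\Psi_f(s)\varphi'(s)\,ds=\int_{-\infty}^\infty f(t)\widehat{\varphi}(t)\,dt=\langle f,\widehat{\varphi}\rangle .$$
   Context: $\mathcal{P}(\mathbb{R})$ is the set of measurable functions $p(\cdot):\mathbb{R}\to[1,\infty]$ (exponent functions), and $p_-=\operatorname{ess\,inf} p$, $p_+=\operatorname{ess\,sup} p$. Convention: $1/\infty=0$. Let $\mathbb{R}_\infty^{p(\cdot)}=\{x: p(x)=\infty\}$. The modular is $\rho_{p(\cdot)}(f)=\int_{\mathbb{R}\setminus \mathbb{R}_\infty^{p(\cdot)}}|f(x)|^{p(x)}dx+\|f\|_{L^\infty(\mathbb{R}_\infty^{p(\cdot)})}\in[0,\infty]$. $L^{p(\cdot)}(\mathbb{R})$ is the space of (complex-valued) Lebesgue measurable functions $f$ on $\mathbb{R}$, identified when equal almost everywhere, with $\rho_{p(\cdot)}(f/\lambda)<\infty$ for some $\lambda>0$, with norm $\|f\|_{p(\cdot)}=\inf\{\lambda>0:\rho_{p(\cdot)}(f/\lambda)\le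 1\}$. For $f\in L^{p(\cdot)}(\mathbb{R})$, $\Psi_f(s)=\int_{-\infty}^{\infty}\left(\frac{1-e^{-ist}}{it}\right)f(t)\,dt$ for $s\ne0$ and $\Psi_f(0)=0$. $\mathcal{S}(\mathbb{R})$ is the Schwartz space, and for $\varphi\in\mathcal{S}(\mathbb{R})$, $\widehat{\varphi}(t)=\int_{-\infty}^\infty e^{-ist}\varphi(s)\,ds$. *)

theory Defs
  imports "HOL-Analysis.Analysis" "HOL-Probability.Essential_Supremum"
begin

subsection \<open>Variable exponent Lebesgue spaces\<close>

definition exponent_functions :: "(real \<Rightarrow> ennreal) set" where
  "exponent_functions = {p \<in> borel_measurable lebesgue. \<forall>x. 1 \<le> p x}"

definition ess_sup_exponent :: "(real \<Rightarrow> ennreal) \<Rightarrow> ennreal" where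
  "ess_sup_exponent p = esssup lebesgue p"

definition infinity_set :: "(real \<Rightarrow> ennreal) \<Rightarrow> real set" where
  "infinity_set p = {x. p x = \<infinity>}"

text \<open>The essential supremum is taken in \<^typ>\<open>ennreal\<close>, so that it is \<open>0\<close> when
  the set where the exponent is infinite is a null set.\<close>

definition modular :: "(real \<Rightarrow> ennreal) \<Rightarrow> (real \<Rightarrow> complex) \<Rightarrow> ennreal" where
  "modular p f =
     (\<integral>\<^sup>+x\<in>- infinity_set p. ennreal (cmod (f x) powr enn2real (p x)) \<partial>lebesgue)
     + esssup (restrict_space lebesgue (infinity_set p)) (\<lambda>x. ennreal (cmod (f x)))"

text \<open>Elements of the space are represented by functions; no quotient by equality almost
  everywhere is formed.\<close>

definition Lp_variable :: "(real \<Rightarrow> ennreal) \<Rightarrow> (real \<Rightarrow> complex) set" where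
  "Lp_variable p =
     {f \<in> borel_measurable lebesgue.
        \<exists>l::real. l > 0 \<and> modular p (\<lambda>x. f x / of_real l) < \<infinity>}"

text \<open>On \<^typ>\<open>ennreal\<close> one has \<open>1 / \<infinity> = 0\<close>.\<close>

definition reciprocal_exponent :: "(real \<Rightarrow> ennreal) \<Rightarrow> real \<Rightarrow> real" where
  "reciprocal_exponent p x = enn2real (1 / p x)"

definition log_holder_at_infinity :: "(real \<Rightarrow> real) \<Rightarrow> real \<Rightarrow> bool" where
  "log_holder_at_infinity r l \<longleftrightarrow>
     (\<exists>C>0. AE x in lebesgue. \<bar>r x - l\<bar> \<le> C / ln (exp 1 + \<bar>x\<bar>))"


subsection \<open>Schwartz functions and tempered distributions\<close>

definition iter_deriv :: "nat \<Rightarrow> (real \<Rightarrow> complex) \<Rightarrow> real \<Rightarrow> complex" where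
  "iter_deriv k \<phi> = ((\<lambda>g x. vector_derivative g (at x)) ^^ k) \<phi>"

definition schwartz :: "(real \<Rightarrow> complex) set" where
  "schwartz =
     {\<phi>. (\<forall>k x. iter_deriv k \<phi> differentiable (at x)) \<and>
          (\<forall>m k. bounded (range (\<lambda>x. of_real (x ^ m) * iter_deriv k \<phi> x)))}"

definition schwartz_seminorm :: "nat \<Rightarrow> nat \<Rightarrow> (real \<Rightarrow> complex) \<Rightarrow> real" where
  "schwartz_seminorm m k \<phi> = (SUP x. cmod (of_real (x ^ m) * iter_deriv k \<phi> x))"

definition schwartz_fourier :: "(real \<Rightarrow> complex) \<Rightarrow> real \<Rightarrow> complex" where
  "schwartz_fourier \<phi> t = (LINT s|lebesgue. exp (- \<i> * of_real s * of_real t) * \<phi> s)"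

text \<open>Distributions are functionals on all functions, of which only the values on
  Schwartz functions matter. The topology of the Schwartz space is metrizable, so continuity is
  sequential continuity.\<close>

definition tempered_distribution :: "((real \<Rightarrow> complex) \<Rightarrow> complex) \<Rightarrow> bool" where
  "tempered_distribution T \<longleftrightarrow>
     (\<forall>\<phi>\<in>schwartz. \<forall>\<psi>\<in>schwartz. T (\<lambda>x. \<phi> x + \<psi> x) = T \<phi> + T \<psi>) \<and>
     (\<forall>c. \<forall>\<phi>\<in>schwartz. T (\<lambda>x. c * \<phi> x) = c * T \<phi>) \<and>
     (\<forall>X. \<forall>\<phi>\<in>schwartz. (\<forall>n. X n \<in> schwartz) \<longrightarrow>
        (\<forall>m k. (\<lambda>n. schwartz_seminorm m k (\<lambda>x. X n x - \<phi> x)) \<longlonglongrightarrow> 0) \<longrightarrow>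
        (\<lambda>n. T (X n)) \<longlonglongrightarrow> T \<phi>)"

text \<open>The bilinear pairing of a function with a test function, without conjugation.\<close>

definition regular_distribution :: "(real \<Rightarrow> complex) \<Rightarrow> (real \<Rightarrow> complex) \<Rightarrow> complex" where
  "regular_distribution g \<phi> = (LINT x|lebesgue. g x * \<phi> x)"

text \<open>Since the Lebesgue integral of a non-integrable function is \<open>0\<close>, integrability
  against test functions is required separately.\<close>

definition induces_tempered_distribution :: "(real \<Rightarrow> complex) \<Rightarrow> bool" where
  "induces_tempered_distribution g \<longleftrightarrow>
     (\<forall>\<phi>\<in>schwartz. integrable lebesgue (\<lambda>x. g x * \<phi> x)) \<and>
     tempered_distribution (regular_distribution g)"

definition distribution_deriv ::
  "((real \<Rightarrow> complex) \<Rightarrow> complex) \<Rightarrow> (real \<Rightarrow> complex) \<Rightarrow> complex" where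
  "distribution_deriv T \<phi> = - T (iter_deriv 1 \<phi>)"

definition tempered_fourier ::
  "((real \<Rightarrow> complex) \<Rightarrow> complex) \<Rightarrow> (real \<Rightarrow> complex) \<Rightarrow> complex" where
  "tempered_fourier T \<phi> = T (schwartz_fourier \<phi>)"


subsection \<open>The Fourier transform as a distributional derivative\<close>

definition Psi_kernel :: "real \<Rightarrow> real \<Rightarrow> complex" where
  "Psi_kernel s t = (1 - exp (- \<i> * of_real s * of_real t)) / (\<i> * of_real t)"

definition Psi :: "(real \<Rightarrow> complex) \<Rightarrow> real \<Rightarrow> complex" where
  "Psi f s = (if s = 0 then 0 else (LINT t|lebesgue. Psi_kernel s t * f t))"

definition fourier_Lp :: "(real \<Rightarrow> complex) \<Rightarrow> (real \<Rightarrow> complex) \<Rightarrow> complex" where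
  "fourier_Lp f = distribution_deriv (regular_distribution (Psi f))"

end

theory Submission
  imports Defs
begin

text \<open>
  Formally \<open>\<partial>\<^sub>s Psi_kernel s t = exp (- \<i> s t)\<close>, so \<open>Psi f\<close> is a primitive of the
  Fourier integral of \<open>f\<close>. For a test function \<open>\<phi>\<close>, moving the \<open>s\<close>-integral inside and
  integrating by parts gives
  \<open>- \<integral> (\<integral> Psi_kernel s t * f t \<partial>t) * \<phi>' s \<partial>s = \<integral> f t * (\<integral> exp (- \<i> s t) * \<phi> s \<partial>s) \<partial>t\<close>.

  All of the analysis rests on a single property of \<open>f\<close>: the function \<open>f t / (1 + \<bar>t\<bar>)\<close> is
  integrable. Since \<open>\<bar>Psi_kernel s t\<bar> \<le> (2 + \<bar>s\<bar>) / (1 + \<bar>t\<bar>)\<close> (\<open>Psi_kernel_norm_le\<close>), this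
  property gives the existence of \<open>Psi f\<close>, its linear growth, and the absolute convergence needed for
  Fubini (\<open>Psi_kernel_pair_integrable\<close>). It also makes \<open>f\<close>, and by linear growth \<open>Psi f\<close>, a tempered
  distribution (\<open>weighted_integrable_induces_tempered_distribution\<close>). The inner integration by parts is
  \<open>schwartz_fourier_eq_kernel_integral\<close>, and \<open>Psi_fourier_identity\<close> puts the pieces together.

  The weighted integrability (\<open>Lp_variable_weighted_integrable\<close>) comes from the hypotheses on the
  exponent. Either of them bounds \<open>p\<close> by a finite constant \<open>P\<close> outside some bounded interval
  (\<open>exponent_bounded_outside_interval\<close>). There a Young type inequality
  splits \<open>\<bar>f\<bar> / (1 + \<bar>t\<bar>)\<close> into \<open>\<bar>f\<bar> powr p\<close> and \<open>(1 + \<bar>t\<bar>) powr (- P / (P - 1))\<close>, both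
  integrable. On the interval, \<open>\<bar>f\<bar>\<close> is at most \<open>1 + \<bar>f\<bar> powr p\<close> where \<open>p\<close> is finite, and is
  essentially bounded where \<open>p\<close> is infinite.
\<close>

section \<open>Integrability of powers of \<open>1 + \<bar>x\<bar>\<close>\<close>

lemma integrable_one_plus_abs_powr:
  fixes q :: real
  assumes q: "1 < q"
  shows "integrable lborel (\<lambda>x. (1 + \<bar>x\<bar>) powr (- q))"
proof -
  let ?f = "\<lambda>x::real. indicator {0..} x * (1 + x) powr (- q)"
  let ?F = "\<lambda>x::real. - ((1 + x) powr (1 - q)) / (q - 1)"
  have "(\<integral>\<^sup>+x. ennreal ((1 + x) powr (- q)) * indicator {0..} x \<partial>lborel) = ennreal (0 - ?F 0)"
  proof (rule nn_integral_FTC_atLeast)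
    show "(?F \<longlongrightarrow> 0) at_top"
    proof -
      have "((\<lambda>x::real. (1 + x) powr (1 - q)) \<longlongrightarrow> 0) at_top"
        using q by (intro tendsto_neg_powr filterlim_tendsto_add_at_top[OF tendsto_const]) 
          (auto simp: filterlim_ident)
      from tendsto_divide[OF tendsto_minus[OF this] tendsto_const[of "q - 1"]] q show ?thesis
        by simp
    qed
    show "DERIV ?F x :> (1 + x) powr (- q)" if "0 \<le> x" for x
      using that q by (auto intro!: derivative_eq_intros simp: divide_simps) (simp add: algebra_simps)
  qed (use q in auto)
  moreover have "(\<integral>\<^sup>+x. ennreal (norm (?f x)) \<partial>lborel)
      = (\<integral>\<^sup>+x. ennreal ((1 + x) powr (- q)) * indicator {0..} x \<partial>lborel)"
    by (intro nn_integral_cong) (auto simp: indicator_def)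
  ultimately have f: "integrable lborel ?f"
    by (intro integrableI_bounded) auto
  \<comment> \<open>The two half-lines are reflections of each other.\<close>
  from lborel_integrable_real_affine[OF f, of "-1" 0]
  have "integrable lborel (\<lambda>x. ?f x + ?f (- x))"
    using f by (intro Bochner_Integration.integrable_add) auto
  then show ?thesis
    by (rule Bochner_Integration.integrable_bound) (auto simp: indicator_def)
qed


section \<open>Variable exponent functions against the weight \<open>1 / (1 + \<bar>x\<bar>)\<close>\<close>

text \<open>A finite essential supremum, raised to at least \<open>2\<close>, serves as \<open>P\<close>. In the log-Hoelder case the reciprocal
  exponent has limit \<open>1\<close>, hence is at least \<open>1 / 2\<close> far enough out, which means \<open>p \<le> 2\<close> there. The
  exponent may then still be unbounded, or infinite, on the remaining bounded interval.\<close>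

lemma exponent_bounded_outside_interval:
  assumes p: "p \<in> exponent_functions"
    and "ess_sup_exponent p < \<infinity> \<or> log_holder_at_infinity (reciprocal_exponent p) 1"
  obtains R P where "1 < P" "AE x in lebesgue. R < \<bar>x\<bar> \<longrightarrow> p x \<le> ennreal P"
  using assms(2)
proof
  assume fin: "ess_sup_exponent p < \<infinity>"
  let ?P = "max 2 (enn2real (esssup lebesgue p))"
  have "esssup lebesgue p \<le> ennreal ?P"
    using fin unfolding ess_sup_exponent_def
    by (cases "esssup lebesgue p") (auto intro: ennreal_leI)
  then have "AE x in lebesgue. 0 < \<bar>x\<bar> \<longrightarrow> p x \<le> ennreal ?P"
    using esssup_AE[of p lebesgue] by (auto elim!: eventually_mono intro: order_trans)
  then show thesis by (intro that[of ?P 0]) auto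
next
  assume "log_holder_at_infinity (reciprocal_exponent p) 1"
  then obtain C where C: "0 < C"
    and ae: "AE x in lebesgue. \<bar>reciprocal_exponent p x - 1\<bar> \<le> C / ln (exp 1 + \<bar>x\<bar>)"
    unfolding log_holder_at_infinity_def by blast
  \<comment> \<open>Beyond this radius the logarithm exceeds \<open>2 * C\<close>, so the deviation from \<open>1\<close> is at most \<open>1 / 2\<close>.\<close>
  have "AE x in lebesgue. exp (2 * C) < \<bar>x\<bar> \<longrightarrow> p x \<le> ennreal 2"
    using ae
  proof eventually_elim
    case (elim x)
    show ?case
    proof
      assume x: "exp (2 * C) < \<bar>x\<bar>"
      have "2 * C \<le> ln (exp 1 + \<bar>x\<bar>)"
        using x by (subst ln_ge_iff) (auto intro: add_pos_nonneg add_increasing)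
      then have "C / ln (exp 1 + \<bar>x\<bar>) \<le> 1 / 2" using C by (simp add: divide_le_eq)
      with elim have half: "1 / 2 \<le> reciprocal_exponent p x" by linarith
      have p1: "1 \<le> p x" using p by (auto simp: exponent_functions_def)
      show "p x \<le> ennreal 2"
      proof (cases "p x")
        case (real r)
        then have r: "1 \<le> r" using p1 by simp
        have "1 / p x = ennreal (1 / r)"
          using real r divide_ennreal[of 1 r] by simp
        then have "1 / 2 \<le> 1 / r" using half r by (simp add: reciprocal_exponent_def)
        then show ?thesis using real r by (simp add: field_simps ennreal_leI del: ennreal_numeral)
      next
        case top
        then show ?thesis using half by (simp add: reciprocal_exponent_def)
      qed
    qed
  qed
  then show thesis by (intro that[of 2]) auto
qed

text \<open>A form of Young's inequality in which the conjugate exponent is that of the upper bound \<open>P\<close> and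
  does not vary with \<open>q\<close>; in particular \<open>q = 1\<close> is covered. If \<open>a \<ge> 1\<close>, the first
  term dominates because \<open>w \<le> 1\<close>. If \<open>a < 1\<close>, lowering the exponent from \<open>P\<close> to \<open>q\<close> only
  increases the power, so it is enough to treat \<open>q = P\<close>; then one compares \<open>w\<close> with
  \<open>a powr (P - 1)\<close>.\<close>

lemma mult_le_powr_add_powr_conjugate:
  fixes a w q P :: real
  assumes "0 \<le> a" "0 < w" "w \<le> 1" "1 \<le> q" "q \<le> P" "1 < P"
  shows "a * w \<le> a powr q + w powr (P / (P - 1))"
proof (cases "1 \<le> a")
  case True
  have "a * w \<le> a" using assms True by (simp add: mult_left_le)
  also have "a = a powr 1" using assms by simp
  also have "\<dots> \<le> a powr q" using assms True by (intro powr_mono) auto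
  finally show ?thesis by (simp add: add_increasing2)
next
  case False
  show ?thesis
  proof (cases "w \<le> a powr (P - 1)")
    case True
    with assms have "0 < a" by (cases "a = 0") auto
    have "a * w \<le> a powr 1 * a powr (P - 1)"
      using True assms by (intro mult_mono) auto
    also have "\<dots> = a powr P" unfolding powr_add[symmetric] by simp
    also have "\<dots> \<le> a powr q" using \<open>0 < a\<close> False assms by (intro powr_mono') auto
    finally show ?thesis by (simp add: add_increasing2)
  next
    case w: False
    then have "(a powr (P - 1)) powr (1 / (P - 1)) \<le> w powr (1 / (P - 1))"
      using assms by (intro powr_mono2) auto
    then have "a \<le> w powr (1 / (P - 1))"
      using assms by (simp add: powr_powr)
    then have "a * w \<le> w powr (1 / (P - 1)) * w powr 1"
      using assms by (intro mult_mono) auto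
    also have "\<dots> = w powr (P / (P - 1))"
    proof -
      have "1 / (P - 1) + 1 = P / (P - 1)" using assms by (simp add: divide_simps)
      then show ?thesis unfolding powr_add[symmetric] by simp
    qed
    finally show ?thesis by (simp add: add_increasing)
  qed
qed

text \<open>After rescaling \<open>f\<close> to a function \<open>h\<close> of finite modular, \<open>\<bar>h\<bar> / (1 + \<bar>x\<bar>)\<close> is dominated
  by the modular integrand \<open>A\<close>, plus an integrable power \<open>B\<close> of the weight (Young, far out), plus a
  constant \<open>D\<close> on the bounded interval where \<open>p\<close> is not controlled.\<close>

lemma Lp_variable_weighted_integrable:
  assumes p: "p \<in> exponent_functions"
    and P: "1 < P" and ae: "AE x in lebesgue. R < \<bar>x\<bar> \<longrightarrow> p x \<le> ennreal P"
    and f: "f \<in> Lp_variable p"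
  shows "integrable lebesgue (\<lambda>t. f t / of_real (1 + \<bar>t\<bar>))"
proof -
  have pm[measurable]: "p \<in> borel_measurable lebesgue" and p1: "\<And>x. 1 \<le> p x"
    using p by (auto simp: exponent_functions_def)
  obtain l :: real where l: "0 < l" and mod: "modular p (\<lambda>x. f x / of_real l) < \<infinity>"
    and fm[measurable]: "f \<in> borel_measurable lebesgue"
    using f by (auto simp: Lp_variable_def)
  define h where "h x = f x / of_real l" for x
  have hm[measurable]: "h \<in> borel_measurable lebesgue" unfolding h_def by measurable
  define I where "I = infinity_set p"
  have I[measurable]: "I \<in> sets lebesgue"
    using measurable_sets[OF pm, of "{\<infinity>}"] by (simp add: I_def infinity_set_def vimage_def)
  define M where "M = esssup (restrict_space lebesgue I) (\<lambda>x. ennreal (cmod (h x)))"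
  let ?A = "\<lambda>x. ennreal (cmod (h x) powr enn2real (p x)) * indicator (- I) x"
  let ?Q = "P / (P - 1)"
  let ?B = "\<lambda>x::real. ennreal ((1 + \<bar>x\<bar>) powr (- ?Q))"
  let ?D = "\<lambda>x. ennreal (1 + enn2real M) * indicator {- R..R} x"
  have "integral\<^sup>N lebesgue ?A + M < \<infinity>"
    using mod by (simp add: modular_def h_def[symmetric] I_def M_def)
  then have A: "integral\<^sup>N lebesgue ?A < \<infinity>" and M: "M < \<infinity>"
    by (auto simp: less_top)
  have Q: "1 < ?Q" using P by (simp add: field_simps)
  have wm: "(\<lambda>x::real. (1 + \<bar>x\<bar>) powr (- ?Q)) \<in> borel_measurable lborel" by measurable
  have B: "integral\<^sup>N lebesgue ?B < \<infinity>"
    using integrable_one_plus_abs_powr[OF Q]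
    by (simp add: nn_integral_completion integrable_iff_bounded)
  have D: "integral\<^sup>N lebesgue ?D < \<infinity>"
    by (subst nn_integral_cmult_indicator) (auto simp: ennreal_mult_less_top emeasure_lborel_Icc_eq)
  have Am: "?A \<in> borel_measurable lebesgue" by measurable
  have Bm: "?B \<in> borel_measurable lebesgue"
    by (rule measurable_compose[OF measurable_completion[OF wm] measurable_ennreal])
  have Dm: "?D \<in> borel_measurable lebesgue"
    by (intro borel_measurable_times_ennreal borel_measurable_indicator borel_measurable_const) simp
  have ess: "AE x in lebesgue. x \<in> I \<longrightarrow> ennreal (cmod (h x)) \<le> M"
    using esssup_AE[of "\<lambda>x. ennreal (cmod (h x))" "restrict_space lebesgue I"] I
    unfolding M_def by (simp add: AE_restrict_space_iff)
  have bd: "AE x in lebesgue. ennreal (norm (h x / of_real (1 + \<bar>x\<bar>))) \<le> ?A x + ?B x + ?D x"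
    using ae ess
  proof eventually_elim
    case (elim x)
    let ?a = "cmod (h x)"
    have nrm: "norm (h x / of_real (1 + \<bar>x\<bar>)) = ?a * (1 / (1 + \<bar>x\<bar>))"
      by (simp add: norm_divide del: of_real_add)
    have le_a: "?a * (1 / (1 + \<bar>x\<bar>)) \<le> ?a" by (rule mult_left_le) auto
    show ?case
    proof (cases "x \<in> I")
      case True
      then have "p x = \<infinity>" by (simp add: I_def infinity_set_def)
      with elim(1) have x: "x \<in> {- R..R}" by (auto simp: top_unique)
      have "ennreal ?a \<le> M" using elim(2) True by simp
      with M have "?a \<le> enn2real M"
        by (cases M) auto
      then have "ennreal (?a * (1 / (1 + \<bar>x\<bar>))) \<le> ennreal (1 + enn2real M)"
        using le_a by (intro ennreal_leI) linarith
      then show ?thesis unfolding nrm using x by (simp add: add_increasing)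
    next
      case False
      define q where "q = enn2real (p x)"
      have pq: "p x = ennreal q" using False
        by (cases "p x") (auto simp: I_def infinity_set_def q_def)
      have q: "1 \<le> q" using p1[of x] unfolding pq by simp
      have A': "?A x = ennreal (?a powr q)" using False by (simp add: q_def)
      show ?thesis
      proof (cases "R < \<bar>x\<bar>")
        case True
        then have qP: "q \<le> P" using elim(1) P q by (simp add: pq)
        have "?a * (1 / (1 + \<bar>x\<bar>)) \<le> ?a powr q + (1 / (1 + \<bar>x\<bar>)) powr ?Q"
          using q qP P by (intro mult_le_powr_add_powr_conjugate) auto
        also have "(1 / (1 + \<bar>x\<bar>)) powr ?Q = (1 + \<bar>x\<bar>) powr (- ?Q)"
          by (simp add: powr_divide powr_minus inverse_eq_divide)
        finally have "ennreal (?a * (1 / (1 + \<bar>x\<bar>))) \<le> ?A x + ?B x"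
          unfolding A' by (simp add: ennreal_leI flip: ennreal_plus)
        then show ?thesis unfolding nrm by (simp add: add_increasing2)
      next
        case False
        then have x: "x \<in> {- R..R}" by auto
        have "?a \<le> 1 + ?a powr q"
        proof (cases "1 \<le> ?a")
          case True
          then have "?a powr 1 \<le> ?a powr q" using q by (intro powr_mono) auto
          then show ?thesis by simp
        qed (simp add: add_increasing2)
        then have "?a * (1 / (1 + \<bar>x\<bar>)) \<le> ?a powr q + (1 + enn2real M)"
          using le_a enn2real_nonneg[of M] by linarith
        then have "ennreal (?a * (1 / (1 + \<bar>x\<bar>))) \<le> ?A x + ?D x"
          unfolding A' using x by (simp add: ennreal_leI flip: ennreal_plus)
        also have "\<dots> \<le> ?A x + ?B x + ?D x" by (intro add_right_mono) auto
        finally show ?thesis unfolding nrm .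
      qed
    qed
  qed
  have w: "(\<lambda>t::real. complex_of_real (1 + \<bar>t\<bar>)) \<in> borel_measurable lebesgue"
    by (intro measurable_completion) measurable
  have "integrable lebesgue (\<lambda>t. h t / of_real (1 + \<bar>t\<bar>))"
  proof (rule integrableI_bounded)
    show "(\<lambda>t. h t / of_real (1 + \<bar>t\<bar>)) \<in> borel_measurable lebesgue"
      by (intro borel_measurable_divide hm w)
    have "(\<integral>\<^sup>+x. ennreal (norm (h x / of_real (1 + \<bar>x\<bar>))) \<partial>lebesgue)
        \<le> (\<integral>\<^sup>+x. ?A x + ?B x + ?D x \<partial>lebesgue)"
      by (rule nn_integral_mono_AE[OF bd])
    also have "\<dots> = integral\<^sup>N lebesgue ?A + integral\<^sup>N lebesgue ?B + integral\<^sup>N lebesgue ?D"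
      using Am Bm Dm by (simp add: nn_integral_add)
    also have "\<dots> < \<infinity>" using A B D by simp
    finally show "(\<integral>\<^sup>+x. ennreal (norm (h x / of_real (1 + \<bar>x\<bar>))) \<partial>lebesgue) < \<infinity>" .
  qed
  then have "integrable lebesgue (\<lambda>t. of_real l * (h t / of_real (1 + \<bar>t\<bar>)))"
    by (rule integrable_mult_right)
  then show ?thesis using l by (simp add: h_def)
qed


section \<open>Decay of Schwartz functions\<close>

lemma power_one_plus_abs_le:
  fixes x :: real
  shows "(1 + \<bar>x\<bar>) ^ m \<le> 2 ^ m * (1 + \<bar>x\<bar> ^ m)"
proof (cases "\<bar>x\<bar> \<le> 1")
  case True
  then have "(1 + \<bar>x\<bar>) ^ m \<le> 2 ^ m" by (intro power_mono) auto
  also have "\<dots> \<le> 2 ^ m * (1 + \<bar>x\<bar> ^ m)" by simp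
  finally show ?thesis .
next
  case False
  then have "(1 + \<bar>x\<bar>) ^ m \<le> (2 * \<bar>x\<bar>) ^ m" by (intro power_mono) auto
  also have "\<dots> \<le> 2 ^ m * (1 + \<bar>x\<bar> ^ m)" by (simp add: power_mult_distrib)
  finally show ?thesis .
qed

text \<open>Continuity on the Schwartz space is tested by seminorms built from the monomials \<open>x ^ m\<close>, while
  estimates need the nowhere vanishing weight \<open>(1 + \<bar>x\<bar>) ^ m\<close>. Two of the seminorms control it.
  The hypothesis provides the boundedness without which the supremum in the seminorm would carry no
  information.\<close>

lemma weighted_norm_le_seminorms:
  assumes "\<And>m. bounded (range (\<lambda>x. of_real (x ^ m) * u x))"
  shows "(1 + \<bar>x\<bar>) ^ m * cmod (u x)
    \<le> 2 ^ m * (schwartz_seminorm 0 0 u + schwartz_seminorm m 0 u)"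
proof -
  have le: "\<bar>x\<bar> ^ k * cmod (u x) \<le> schwartz_seminorm k 0 u" for k
  proof -
    from assms[of k] obtain B where "\<And>y. cmod (of_real (y ^ k) * u y) \<le> B"
      unfolding bounded_iff by blast
    then have "bdd_above (range (\<lambda>y. cmod (of_real (y ^ k) * u y)))"
      by (intro bdd_aboveI2)
    from cSUP_upper[OF UNIV_I this, of x] show ?thesis
      by (simp add: schwartz_seminorm_def iter_deriv_def norm_mult norm_power)
  qed
  have "(1 + \<bar>x\<bar>) ^ m * cmod (u x) \<le> 2 ^ m * (1 + \<bar>x\<bar> ^ m) * cmod (u x)"
    by (intro mult_right_mono power_one_plus_abs_le) auto
  also have "\<dots> = 2 ^ m * (\<bar>x\<bar> ^ 0 * cmod (u x) + \<bar>x\<bar> ^ m * cmod (u x))"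
    by (simp add: algebra_simps)
  also have "\<dots> \<le> 2 ^ m * (schwartz_seminorm 0 0 u + schwartz_seminorm m 0 u)"
    by (intro mult_left_mono add_mono le) auto
  finally show ?thesis .
qed

lemma schwartz_bounded:
  assumes "\<phi> \<in> schwartz"
  shows "bounded (range (\<lambda>x. of_real (x ^ m) * \<phi> x))"
proof -
  have "bounded (range (\<lambda>x. of_real (x ^ m) * iter_deriv 0 \<phi> x))"
    using assms unfolding schwartz_def by blast
  then show ?thesis by (simp add: iter_deriv_def)
qed

lemma schwartz_diff_bounded:
  assumes "\<phi> \<in> schwartz" "\<psi> \<in> schwartz"
  shows "bounded (range (\<lambda>x. of_real (x ^ m) * (\<phi> x - \<psi> x)))"
  using bounded_minus_comp[OF schwartz_bounded[OF assms(1)] schwartz_bounded[OF assms(2)], of m m]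
  by (simp add: right_diff_distrib)

lemma schwartz_decay:
  assumes "\<phi> \<in> schwartz"
  obtains C where "0 \<le> C" "\<And>x. (1 + \<bar>x\<bar>) ^ m * cmod (\<phi> x) \<le> C"
proof
  let ?C = "2 ^ m * (schwartz_seminorm 0 0 \<phi> + schwartz_seminorm m 0 \<phi>)"
  show le: "(1 + \<bar>x\<bar>) ^ m * cmod (\<phi> x) \<le> ?C" for x
    by (rule weighted_norm_le_seminorms[OF schwartz_bounded[OF assms]])
  show "0 \<le> ?C"
    by (rule order_trans[OF _ le[of 0]]) simp
qed

lemma iter_deriv_one: "iter_deriv 1 \<phi> = (\<lambda>x. vector_derivative \<phi> (at x))"
  by (simp add: iter_deriv_def)

lemma schwartz_deriv:
  assumes "\<phi> \<in> schwartz"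
  shows "(\<lambda>x. vector_derivative \<phi> (at x)) \<in> schwartz"
proof -
  have "iter_deriv k (\<lambda>x. vector_derivative \<phi> (at x)) = iter_deriv (Suc k) \<phi>" for k
    unfolding iter_deriv_def funpow_Suc_right o_apply ..
  with assms show ?thesis unfolding schwartz_def by (simp del: of_real_power)
qed

lemma schwartz_has_vector_derivative:
  assumes "\<phi> \<in> schwartz"
  shows "(\<phi> has_vector_derivative vector_derivative \<phi> (at x)) (at x)"
proof -
  have "iter_deriv 0 \<phi> differentiable (at x)" using assms unfolding schwartz_def by blast
  then show ?thesis by (simp add: iter_deriv_def vector_derivative_works)
qed

lemma schwartz_isCont:
  assumes "\<phi> \<in> schwartz"
  shows "isCont \<phi> x"
  using schwartz_has_vector_derivative[OF assms] has_vector_derivative_continuous by blast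

lemma schwartz_borel [measurable]:
  assumes "\<phi> \<in> schwartz"
  shows "\<phi> \<in> borel_measurable borel"
  by (intro borel_measurable_continuous_onI continuous_at_imp_continuous_on ballI
      schwartz_isCont assms)

section \<open>Weighted integrable functions as tempered distributions\<close>

text \<open>Moving the weight from \<open>g\<close> to \<open>u\<close> bounds the pairing by the supremum of the weighted \<open>u\<close> times
  the \<open>L\<^sup>1\<close> norm of \<open>g / (1 + \<bar>x\<bar>) ^ m\<close>. Applied to a difference of test functions
  it gives continuity of the pairing; applied to the kernel it gives the existence of \<open>Psi\<close>.\<close>

lemma pairing_bound:
  fixes g u :: "real \<Rightarrow> complex"
  assumes g: "integrable lebesgue (\<lambda>x. g x / of_real ((1 + \<bar>x\<bar>) ^ m))"
    and u: "u \<in> borel_measurable borel"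
    and le: "\<And>x. (1 + \<bar>x\<bar>) ^ m * cmod (u x) \<le> B"
  shows "integrable lebesgue (\<lambda>x. g x * u x)"
    and "cmod (LINT x|lebesgue. g x * u x)
      \<le> B * (LINT x|lebesgue. cmod (g x / of_real ((1 + \<bar>x\<bar>) ^ m)))"
proof -
  let ?h = "\<lambda>x. g x / of_real ((1 + \<bar>x\<bar>) ^ m)"
  have nz: "1 + \<bar>x\<bar> \<noteq> 0" for x :: real by linarith
  have nz': "1 + complex_of_real \<bar>x\<bar> \<noteq> 0" for x :: real
    using nz[of x] by (metis of_real_1 of_real_add of_real_eq_0_iff)
  have um: "u \<in> borel_measurable lebesgue"
    using u by (simp add: measurable_completion)
  have w: "(\<lambda>x::real. complex_of_real ((1 + \<bar>x\<bar>) ^ m)) \<in> borel_measurable lebesgue"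
    by (intro measurable_completion) measurable
  have eq: "g x * u x = ?h x * (of_real ((1 + \<bar>x\<bar>) ^ m) * u x)" for x
    using nz'[of x] by simp
  have bd: "cmod (g x * u x) \<le> cmod (?h x) * B" for x
    unfolding eq norm_mult[of "?h x"] using le[of x]
    by (intro mult_left_mono) (auto simp: norm_mult simp del: of_real_power of_real_add)
  have hB: "integrable lebesgue (\<lambda>x. cmod (?h x) * B)"
    by (intro integrable_mult_left integrable_norm g)
  have meas: "(\<lambda>x. g x * u x) \<in> borel_measurable lebesgue"
    unfolding eq using g w um by (intro borel_measurable_times) auto
  have B: "0 \<le> B" by (rule order_trans[OF _ le[of 0]]) simp
  show int: "integrable lebesgue (\<lambda>x. g x * u x)"
  proof (rule Bochner_Integration.integrable_bound[OF hB meas], intro AE_I2)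
    show "cmod (g x * u x) \<le> norm (cmod (?h x) * B)" for x
      using bd[of x] B by (simp add: norm_mult)
  qed
  have "cmod (LINT x|lebesgue. g x * u x) \<le> (LINT x|lebesgue. cmod (?h x) * B)"
    using bd by (intro order_trans[OF integral_norm_bound]
        Bochner_Integration.integral_mono[OF integrable_norm[OF int] hB])
  then show "cmod (LINT x|lebesgue. g x * u x) \<le> B * (LINT x|lebesgue. cmod (?h x))"
    by (simp add: mult.commute)
qed

lemma weighted_integrable_schwartz_pairing:
  assumes "integrable lebesgue (\<lambda>x. g x / of_real ((1 + \<bar>x\<bar>) ^ m))" "\<phi> \<in> schwartz"
  shows "integrable lebesgue (\<lambda>x. g x * \<phi> x)"
  by (rule pairing_bound(1)[OF assms(1) schwartz_borel[OF assms(2)]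
        weighted_norm_le_seminorms[OF schwartz_bounded[OF assms(2)]]])

lemma weighted_integrable_induces_tempered_distribution:
  assumes g: "integrable lebesgue (\<lambda>x. g x / of_real ((1 + \<bar>x\<bar>) ^ m))"
  shows "induces_tempered_distribution g"
proof -
  note int = weighted_integrable_schwartz_pairing[OF g]
  have add: "regular_distribution g (\<lambda>x. \<phi> x + \<psi> x)
      = regular_distribution g \<phi> + regular_distribution g \<psi>"
    if "\<phi> \<in> schwartz" "\<psi> \<in> schwartz" for \<phi> \<psi>
    using int that by (simp add: regular_distribution_def distrib_left)
  have scale: "regular_distribution g (\<lambda>x. c * \<phi> x) = c * regular_distribution g \<phi>" for c \<phi>
    by (simp add: regular_distribution_def mult.left_commute)
  have cont: "(\<lambda>n. regular_distribution g (X n)) \<longlonglongrightarrow> regular_distribution g \<phi>"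
    if \<phi>: "\<phi> \<in> schwartz" and X: "\<And>n. X n \<in> schwartz"
      and lim: "\<And>m k. (\<lambda>n. schwartz_seminorm m k (\<lambda>x. X n x - \<phi> x)) \<longlonglongrightarrow> 0" for X \<phi>
  proof -
    let ?d = "\<lambda>n x. X n x - \<phi> x"
    let ?B = "\<lambda>n. 2 ^ m * (schwartz_seminorm 0 0 (?d n) + schwartz_seminorm m 0 (?d n))
      * (LINT x|lebesgue. cmod (g x / of_real ((1 + \<bar>x\<bar>) ^ m)))"
    have "cmod (regular_distribution g (X n) - regular_distribution g \<phi>) \<le> ?B n" for n
    proof -
      have "regular_distribution g (X n) - regular_distribution g \<phi>
          = (LINT x|lebesgue. g x * ?d n x)"
        using int[OF \<phi>] int[OF X] by (simp add: regular_distribution_def right_diff_distrib)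
      also have "cmod \<dots> \<le> ?B n"
        by (intro pairing_bound(2)[OF g] weighted_norm_le_seminorms schwartz_diff_bounded X \<phi>
            borel_measurable_diff schwartz_borel)
      finally show ?thesis .
    qed
    then have "\<forall>\<^sub>F n in sequentially.
        cmod (regular_distribution g (X n) - regular_distribution g \<phi>) \<le> ?B n"
      by (rule always_eventually[OF allI])
    moreover have "?B \<longlonglongrightarrow> 2 ^ m * (0 + 0) * (LINT x|lebesgue. cmod (g x / of_real ((1 + \<bar>x\<bar>) ^ m)))"
      by (intro tendsto_intros lim)
    then have "?B \<longlonglongrightarrow> 0" by simp
    ultimately have "(\<lambda>n. regular_distribution g (X n) - regular_distribution g \<phi>) \<longlonglongrightarrow> 0"
      by (rule Lim_null_comparison)
    then show ?thesis by (simp add: LIM_zero_iff)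
  qed
  show ?thesis
    unfolding induces_tempered_distribution_def tempered_distribution_def
    using int add scale cont by blast
qed

lemma schwartz_linear_weight_integrable:
  assumes "\<phi> \<in> schwartz"
  shows "integrable lborel (\<lambda>s. of_real ((2 + \<bar>s\<bar>)) * \<phi> s)"
proof -
  obtain C where C: "0 \<le> C" "\<And>x. (1 + \<bar>x\<bar>) ^ 3 * cmod (\<phi> x) \<le> C"
    using schwartz_decay[OF assms] by blast
  have int: "integrable lborel (\<lambda>x::real. 2 * C * (1 + \<bar>x\<bar>) powr (- 2))"
    by (intro integrable_mult_right integrable_one_plus_abs_powr) auto
  show ?thesis
  proof (rule Bochner_Integration.integrable_bound[OF int])
    show "(\<lambda>s. of_real ((2 + \<bar>s\<bar>)) * \<phi> s) \<in> borel_measurable lborel"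
      using schwartz_borel[OF assms] by measurable
    have "cmod (of_real ((2 + \<bar>s\<bar>)) * \<phi> s) \<le> 2 * C * (1 + \<bar>s\<bar>) powr (- 2)" for s
    proof -
      have pr: "(1 + \<bar>s\<bar>) powr (- 2) = 1 / (1 + \<bar>s\<bar>) ^ 2"
        by (simp add: powr_minus powr_numeral divide_simps)
      have "cmod (of_real (2 + \<bar>s\<bar>) * \<phi> s) = (2 + \<bar>s\<bar>) * cmod (\<phi> s)"
        by (simp add: norm_mult del: of_real_add)
      also have "\<dots> \<le> 2 * (1 + \<bar>s\<bar>) * cmod (\<phi> s)"
        by (intro mult_right_mono) auto
      also have "\<dots> = 2 * ((1 + \<bar>s\<bar>) ^ 3 * cmod (\<phi> s)) / (1 + \<bar>s\<bar>) ^ 2"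
        by (simp add: power3_eq_cube power2_eq_square)
      also have "\<dots> \<le> 2 * C / (1 + \<bar>s\<bar>) ^ 2"
        using C(2)[of s] by (intro divide_right_mono) auto
      finally show ?thesis unfolding pr by simp
    qed
    then show "AE s in lborel. norm (of_real ((2 + \<bar>s\<bar>)) * \<phi> s) \<le> norm (2 * C * (1 + \<bar>s\<bar>) powr (- 2))"
      using C(1) by (auto simp: abs_mult)
  qed
qed


section \<open>Integration by parts against the kernel\<close>

text \<open>The two elementary bounds \<open>\<bar>s\<bar>\<close> (near \<open>t = 0\<close>) and \<open>2 / \<bar>t\<bar>\<close> (for large \<open>t\<close>) are
  merged into one that separates the variables, which makes the double integral below a product.\<close>

lemma Psi_kernel_norm_le: "cmod (Psi_kernel s t) \<le> (2 + \<bar>s\<bar>) / (1 + \<bar>t\<bar>)"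
proof (cases "t = 0")
  case True
  then show ?thesis by (simp add: Psi_kernel_def)
next
  case False
  let ?N = "cmod (1 - exp (- \<i> * of_real s * of_real t))"
  have "- \<i> * of_real s * of_real t = \<i> * of_real (- s * t)" by simp
  then have N: "?N = 2 * \<bar>sin (- s * t / 2)\<bar>"
    using dist_exp_i_1[of "- s * t"] by (metis dist_commute dist_norm)
  have "\<bar>sin (- s * t / 2)\<bar> \<le> \<bar>- s * t / 2\<bar>" by (rule abs_sin_x_le_abs_x)
  then have 1: "?N \<le> \<bar>s\<bar> * \<bar>t\<bar>" unfolding N by (simp add: abs_mult)
  have 2: "?N \<le> 2" unfolding N using abs_sin_le_one[of "- s * t / 2"] by simp
  have "?N * (1 + \<bar>t\<bar>) = ?N + ?N * \<bar>t\<bar>" by (simp add: distrib_left)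
  also have "\<dots> \<le> \<bar>s\<bar> * \<bar>t\<bar> + 2 * \<bar>t\<bar>"
    using 1 2 by (intro add_mono mult_right_mono) auto
  finally have "?N * (1 + \<bar>t\<bar>) \<le> (2 + \<bar>s\<bar>) * \<bar>t\<bar>" by (simp add: algebra_simps)
  then show ?thesis
    using False unfolding Psi_kernel_def norm_divide norm_mult
    by (simp add: frac_le_eq divide_le_eq le_divide_eq)
qed

lemma Psi_kernel_has_vector_derivative:
  assumes "t \<noteq> 0"
  shows "((\<lambda>s. Psi_kernel s t) has_vector_derivative exp (- \<i> * of_real s * of_real t)) (at s)"
proof -
  have "((\<lambda>z. (1 - exp (- \<i> * z * of_real t)) / (\<i> * of_real t))
      has_field_derivative exp (- \<i> * of_real s * of_real t)) (at (of_real s))"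
    using assms by (auto intro!: derivative_eq_intros)
  from has_vector_derivative_real_field[OF this, of UNIV] show ?thesis
    by (simp add: Psi_kernel_def)
qed

lemma integral_lborel_of_derivative_vanishing_at_ends:
  fixes F :: "real \<Rightarrow> 'a::euclidean_space"
  assumes F: "\<And>x. (F has_vector_derivative f x) (at x)"
    and f: "\<And>x. isCont f x"
    and int: "integrable lborel f"
    and lim: "(F \<longlongrightarrow> 0) at_top" "(F \<longlongrightarrow> 0) at_bot"
  shows "(LINT x|lborel. f x) = 0"
proof -
  have "(LBINT x=-\<infinity>..\<infinity>. f x) = 0 - 0"
    by (rule interval_integral_FTC_integrable[where F = F])
      (use assms in \<open>auto simp: ereal_tendsto_simps set_integrable_def\<close>)
  then show ?thesis
    by (simp add: interval_lebesgue_integral_def set_lebesgue_integral_def)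
qed

lemma schwartz_tendsto_0:
  assumes "\<phi> \<in> schwartz"
  shows "(\<phi> \<longlongrightarrow> 0) at_top" "(\<phi> \<longlongrightarrow> 0) at_bot"
proof -
  obtain C where C: "\<And>x. (1 + \<bar>x\<bar>) ^ 1 * cmod (\<phi> x) \<le> C"
    using schwartz_decay[OF assms] by blast
  have le: "norm (\<phi> x) \<le> C / (1 + \<bar>x\<bar>)" for x
    using C[of x] by (simp add: le_divide_eq mult.commute add_pos_nonneg)
  have "((\<lambda>x. C / (1 + \<bar>x\<bar>)) \<longlongrightarrow> 0) at_top"
    by (intro tendsto_divide_0[OF tendsto_const] filterlim_at_top_imp_at_infinity
        filterlim_tendsto_add_at_top[OF tendsto_const] filterlim_abs_real)
  then show "(\<phi> \<longlongrightarrow> 0) at_top"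
    by (rule Lim_null_comparison[rotated]) (use le in auto)
  have "filterlim (\<lambda>x::real. \<bar>x\<bar>) at_top at_bot"
    unfolding filterlim_at_bot_mirror by (simp add: filterlim_abs_real)
  then have "((\<lambda>x. C / (1 + \<bar>x\<bar>)) \<longlongrightarrow> 0) at_bot"
    by (intro tendsto_divide_0[OF tendsto_const] filterlim_at_top_imp_at_infinity
        filterlim_tendsto_add_at_top[OF tendsto_const])
  then show "(\<phi> \<longlongrightarrow> 0) at_bot"
    by (rule Lim_null_comparison[rotated]) (use le in auto)
qed

lemma Psi_kernel_schwartz_integrable:
  assumes "\<phi> \<in> schwartz"
  shows "integrable lborel (\<lambda>s. Psi_kernel s t * \<phi> s)"
proof (rule Bochner_Integration.integrable_bound[OF schwartz_linear_weight_integrable[OF assms]])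
  note [measurable] = schwartz_borel[OF assms]
  show "(\<lambda>s. Psi_kernel s t * \<phi> s) \<in> borel_measurable lborel"
    unfolding Psi_kernel_def by measurable
  have "(2 + \<bar>s\<bar>) / (1 + \<bar>t\<bar>) \<le> 2 + \<bar>s\<bar>" for s
    by (simp add: divide_le_eq distrib_left)
  then have "cmod (Psi_kernel s t) \<le> 2 + \<bar>s\<bar>" for s
    using Psi_kernel_norm_le order_trans by blast
  then show "AE s in lborel. norm (Psi_kernel s t * \<phi> s) \<le> norm (of_real (2 + \<bar>s\<bar>) * \<phi> s)"
    by (auto simp: norm_mult intro!: mult_right_mono simp del: of_real_add)
qed

text \<open>The derivative in \<open>s\<close> of \<open>Psi_kernel s t * \<phi> s\<close> has vanishing integral over the line, as the
  kernel is bounded in \<open>s\<close> for fixed \<open>t \<noteq> 0\<close> and \<open>\<phi>\<close> vanishes at infinity. For \<open>t = 0\<close> the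
  identity fails in general, since division by zero makes the kernel \<open>0\<close> there.\<close>

lemma schwartz_fourier_eq_kernel_integral:
  assumes \<phi>: "\<phi> \<in> schwartz" and t: "t \<noteq> 0"
  shows "schwartz_fourier \<phi> t = - (LINT s|lborel. Psi_kernel s t * vector_derivative \<phi> (at s))"
proof -
  let ?\<phi>' = "\<lambda>s. vector_derivative \<phi> (at s)"
  let ?e = "\<lambda>s. exp (- \<i> * of_real s * of_real t)"
  note \<phi>' = schwartz_deriv[OF \<phi>]
  note [measurable] = schwartz_borel[OF \<phi>] schwartz_borel[OF \<phi>']
  have ne: "cmod (?e s) = 1" for s
    using norm_exp_i_times[of "- s * t"] by (simp add: mult.assoc)
  have int1: "integrable lborel (\<lambda>s. ?e s * \<phi> s)"
  proof (rule Bochner_Integration.integrable_bound[OF schwartz_linear_weight_integrable[OF \<phi>]])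
    show "(\<lambda>s. ?e s * \<phi> s) \<in> borel_measurable lborel"
      by measurable
    have "cmod (\<phi> s) \<le> (2 + \<bar>s\<bar>) * cmod (\<phi> s)" for s
      by (simp add: distrib_right)
    then show "AE s in lborel. norm (?e s * \<phi> s) \<le> norm (of_real (2 + \<bar>s\<bar>) * \<phi> s)"
      unfolding norm_mult ne by (simp del: of_real_add)
  qed
  have int2: "integrable lborel (\<lambda>s. Psi_kernel s t * ?\<phi>' s)"
    by (rule Psi_kernel_schwartz_integrable[OF \<phi>'])
  have "(LINT s|lborel. Psi_kernel s t * ?\<phi>' s + ?e s * \<phi> s) = 0"
  proof (rule integral_lborel_of_derivative_vanishing_at_ends)
    show "((\<lambda>s. Psi_kernel s t * \<phi> s) has_vector_derivative
        Psi_kernel s t * ?\<phi>' s + ?e s * \<phi> s) (at s)" for s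
      by (rule has_vector_derivative_mult[OF Psi_kernel_has_vector_derivative[OF t]
            schwartz_has_vector_derivative[OF \<phi>]])
    show "isCont (\<lambda>s. Psi_kernel s t * ?\<phi>' s + ?e s * \<phi> s) s" for s
      by (intro continuous_intros schwartz_isCont[OF \<phi>] schwartz_isCont[OF \<phi>']
          has_vector_derivative_continuous[OF Psi_kernel_has_vector_derivative[OF t]])
    show "integrable lborel (\<lambda>s. Psi_kernel s t * ?\<phi>' s + ?e s * \<phi> s)"
      using int1 int2 by simp
    have bd: "Bfun (\<lambda>s. Psi_kernel s t) F" for F
    proof (rule BfunI)
      show "eventually (\<lambda>s. norm (Psi_kernel s t) \<le> 2 / \<bar>t\<bar>) F"
      proof (rule always_eventually, rule allI)
        fix s
        have "norm (1 - ?e s) \<le> 2" using norm_triangle_ineq4[of 1 "?e s"] ne[of s] by simp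
        then show "norm (Psi_kernel s t) \<le> 2 / \<bar>t\<bar>"
          unfolding Psi_kernel_def norm_divide norm_mult by (simp add: divide_right_mono)
      qed
    qed
    show "((\<lambda>s. Psi_kernel s t * \<phi> s) \<longlongrightarrow> 0) at_top"
      using bounded_bilinear.Bfun_prod_Zfun[OF bounded_bilinear_mult bd] schwartz_tendsto_0(1)[OF \<phi>]
      by (simp add: tendsto_Zfun_iff)
    show "((\<lambda>s. Psi_kernel s t * \<phi> s) \<longlongrightarrow> 0) at_bot"
      using bounded_bilinear.Bfun_prod_Zfun[OF bounded_bilinear_mult bd] schwartz_tendsto_0(2)[OF \<phi>]
      by (simp add: tendsto_Zfun_iff)
  qed
  moreover have "schwartz_fourier \<phi> t = (LINT s|lborel. ?e s * \<phi> s)"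
    unfolding schwartz_fourier_def by (intro integral_completion) measurable
  ultimately show ?thesis
    using int1 int2 by (simp add: eq_neg_iff_add_eq_0 add.commute)
qed


section \<open>Interchanging the two integrals\<close>

lemma integrable_pair_times:
  fixes a b :: "real \<Rightarrow> complex"
  assumes a: "integrable lborel a" and b: "integrable lborel b"
  shows "integrable (lborel \<Otimes>\<^sub>M lborel) (\<lambda>(s, t). a s * b t)"
proof (rule lborel_pair.Fubini_integrable)
  note [measurable] = borel_measurable_integrable[OF a] borel_measurable_integrable[OF b]
  show "(\<lambda>(s, t). a s * b t) \<in> borel_measurable (lborel \<Otimes>\<^sub>M lborel)"
    by measurable
qed (use a b in \<open>simp_all add: norm_mult\<close>)

lemma Psi_kernel_pair_integrable:
  fixes g :: "real \<Rightarrow> complex"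
  assumes g: "g \<in> borel_measurable borel"
    and int: "integrable lborel (\<lambda>t. g t / of_real (1 + \<bar>t\<bar>))"
    and \<psi>: "\<psi> \<in> schwartz"
  shows "integrable (lborel \<Otimes>\<^sub>M lborel) (\<lambda>(s, t). Psi_kernel s t * g t * \<psi> s)"
proof (rule Bochner_Integration.integrable_bound)
  show "integrable (lborel \<Otimes>\<^sub>M lborel)
      (\<lambda>(s, t). of_real (2 + \<bar>s\<bar>) * \<psi> s * (g t / of_real (1 + \<bar>t\<bar>)))"
    by (rule integrable_pair_times[OF schwartz_linear_weight_integrable[OF \<psi>] int])
  note [measurable] = schwartz_borel[OF \<psi>] g
  show "(\<lambda>(s, t). Psi_kernel s t * g t * \<psi> s) \<in> borel_measurable (lborel \<Otimes>\<^sub>M lborel)"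
    unfolding Psi_kernel_def by measurable
  have "cmod (Psi_kernel s t * g t * \<psi> s)
      \<le> cmod (of_real (2 + \<bar>s\<bar>) * \<psi> s * (g t / of_real (1 + \<bar>t\<bar>)))" for s t
  proof -
    have "cmod (Psi_kernel s t * g t * \<psi> s) \<le> (2 + \<bar>s\<bar>) / (1 + \<bar>t\<bar>) * cmod (g t) * cmod (\<psi> s)"
      unfolding norm_mult by (intro mult_right_mono Psi_kernel_norm_le) auto
    then show ?thesis
      by (simp add: norm_mult norm_divide mult_ac del: of_real_add)
  qed
  then show "AE z in lborel \<Otimes>\<^sub>M lborel. norm (case z of (s, t) \<Rightarrow> Psi_kernel s t * g t * \<psi> s)
      \<le> norm (case z of (s, t) \<Rightarrow> of_real (2 + \<bar>s\<bar>) * \<psi> s * (g t / of_real (1 + \<bar>t\<bar>)))"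
    by auto
qed


section \<open>The transform of a weighted integrable function\<close>

lemma lebesgue_measurable_borel_representative:
  fixes f :: "real \<Rightarrow> complex"
  assumes "f \<in> borel_measurable lebesgue"
  obtains g where "g \<in> borel_measurable borel" "AE x in lebesgue. f x = g x"
proof -
  have "(\<lambda>x. Re (f x)) \<in> borel_measurable lebesgue" "(\<lambda>x. Im (f x)) \<in> borel_measurable lebesgue"
    using assms by measurable
  from this[THEN completion_ex_borel_measurable_real]
  obtain u v where uv: "u \<in> borel_measurable lborel" "v \<in> borel_measurable lborel"
    and ae: "AE x in lborel. Re (f x) = u x" "AE x in lborel. Im (f x) = v x"
    by blast
  show thesis
  proof
    show "(\<lambda>x. Complex (u x) (v x)) \<in> borel_measurable borel"
      unfolding borel_measurable_complex_iff using uv by simp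
    show "AE x in lebesgue. f x = Complex (u x) (v x)"
      using AE_completion[OF ae(1)] AE_completion[OF ae(2)] by eventually_elim (simp add: complex_eq_iff)
  qed
qed

lemma weighted_imp_lebesgue_measurable:
  fixes f :: "real \<Rightarrow> complex"
  assumes "integrable lebesgue (\<lambda>t. f t / of_real (1 + \<bar>t\<bar>))"
  shows "f \<in> borel_measurable lebesgue"
proof -
  have "(\<lambda>t::real. complex_of_real (1 + \<bar>t\<bar>)) \<in> borel_measurable lebesgue"
    by (intro measurable_completion) measurable
  then have "(\<lambda>t. f t / of_real (1 + \<bar>t\<bar>) * of_real (1 + \<bar>t\<bar>)) \<in> borel_measurable lebesgue"
    using assms by (intro borel_measurable_times) auto
  moreover have "complex_of_real (1 + \<bar>t\<bar>) \<noteq> 0" for t :: real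
    unfolding of_real_eq_0_iff by linarith
  ultimately show ?thesis by (simp del: of_real_add)
qed

lemma Psi_eq_integral: "Psi f s = (LINT t|lebesgue. Psi_kernel s t * f t)"
  by (simp add: Psi_def Psi_kernel_def)

text \<open>The \<open>\<sigma>\<close>-finite product and Fubini's theorem are applied to Borel functions on
  \<open>lborel\<close>, whereas \<open>f\<close> is only Lebesgue measurable. A Borel function equal to \<open>f\<close> almost everywhere
  has the same \<open>Psi\<close> at every point.\<close>

lemma weighted_borel_representative:
  fixes f :: "real \<Rightarrow> complex"
  assumes f: "integrable lebesgue (\<lambda>t. f t / of_real (1 + \<bar>t\<bar>))"
  obtains g where "g \<in> borel_measurable borel" "AE t in lebesgue. f t = g t"
    "integrable lborel (\<lambda>t. g t / of_real (1 + \<bar>t\<bar>))"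
    "\<And>s. Psi f s = (LINT t|lborel. Psi_kernel s t * g t)"
proof -
  note fm = weighted_imp_lebesgue_measurable[OF f]
  obtain g where g[measurable]: "g \<in> borel_measurable borel" and ae: "AE t in lebesgue. f t = g t"
    using lebesgue_measurable_borel_representative[OF fm] .
  have gm: "(\<lambda>t. g t / of_real (1 + \<bar>t\<bar>)) \<in> borel_measurable lborel"
    and km: "(\<lambda>t. Psi_kernel s t * g t) \<in> borel_measurable lborel" for s
    unfolding Psi_kernel_def by measurable
  show thesis
  proof (rule that[OF g ae])
    have "integrable lebesgue (\<lambda>t. g t / of_real (1 + \<bar>t\<bar>))"
      by (rule integrable_cong_AE_imp[OF f measurable_completion[OF gm]]) (use ae in auto)
    then show "integrable lborel (\<lambda>t. g t / of_real (1 + \<bar>t\<bar>))"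
      by (simp only: integrable_completion[OF gm])
    fix s
    have "(\<lambda>t. Psi_kernel s t) \<in> borel_measurable lebesgue"
      unfolding Psi_kernel_def by (intro measurable_completion) measurable
    then have "(LINT t|lebesgue. Psi_kernel s t * f t) = (LINT t|lebesgue. Psi_kernel s t * g t)"
      using fm ae by (intro integral_cong_AE borel_measurable_times measurable_completion[OF km]) auto
    then show "Psi f s = (LINT t|lborel. Psi_kernel s t * g t)"
      by (simp only: Psi_eq_integral integral_completion[OF km])
  qed
qed

lemma Psi_kernel_integrable:
  fixes f :: "real \<Rightarrow> complex"
  assumes f: "integrable lebesgue (\<lambda>t. f t / of_real (1 + \<bar>t\<bar>))"
  shows "integrable lebesgue (\<lambda>t. Psi_kernel s t * f t)"
proof -
  have [measurable]: "(\<lambda>t. Psi_kernel s t) \<in> borel_measurable borel"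
    unfolding Psi_kernel_def by measurable
  have "integrable lebesgue (\<lambda>t. f t / of_real ((1 + \<bar>t\<bar>) ^ 1))"
    using f by simp
  then show ?thesis
    by (subst mult.commute, rule pairing_bound(1)[where B = "2 + \<bar>s\<bar>"])
      (use Psi_kernel_norm_le[of s] in \<open>auto simp: field_simps\<close>)
qed

lemma Psi_norm_le:
  fixes f :: "real \<Rightarrow> complex"
  assumes f: "integrable lebesgue (\<lambda>t. f t / of_real (1 + \<bar>t\<bar>))"
  shows "cmod (Psi f s) \<le> (2 + \<bar>s\<bar>) * (LINT t|lebesgue. cmod (f t / of_real (1 + \<bar>t\<bar>)))"
proof -
  have "cmod (Psi_kernel s t * f t) \<le> (2 + \<bar>s\<bar>) * cmod (f t / of_real (1 + \<bar>t\<bar>))" for t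
    using mult_right_mono[OF Psi_kernel_norm_le norm_ge_zero[of "f t"], of s t]
    by (simp add: norm_mult norm_divide del: of_real_add)
  then have "cmod (Psi f s) \<le> (LINT t|lebesgue. (2 + \<bar>s\<bar>) * cmod (f t / of_real (1 + \<bar>t\<bar>)))"
    unfolding Psi_eq_integral
    by (intro order_trans[OF integral_norm_bound] Bochner_Integration.integral_mono
        integrable_norm integrable_mult_right Psi_kernel_integrable f)
  then show ?thesis by simp
qed

text \<open>Linear growth of \<open>Psi f\<close> leaves, after division by \<open>(1 + \<bar>s\<bar>) ^ 3\<close>, the integrable decay
  \<open>(1 + \<bar>s\<bar>) powr (- 2)\<close>.\<close>

lemma Psi_weighted_integrable:
  fixes f :: "real \<Rightarrow> complex"
  assumes f: "integrable lebesgue (\<lambda>t. f t / of_real (1 + \<bar>t\<bar>))"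
  shows "integrable lebesgue (\<lambda>s. Psi f s / of_real ((1 + \<bar>s\<bar>) ^ 3))"
proof -
  obtain g where [measurable]: "g \<in> borel_measurable borel"
    and Psi: "\<And>s. Psi f s = (LINT t|lborel. Psi_kernel s t * g t)"
    using weighted_borel_representative[OF f] by blast
  have "(\<lambda>s. LINT t|lborel. Psi_kernel s t * g t) \<in> borel_measurable borel"
    unfolding Psi_kernel_def by measurable
  then have [measurable]: "Psi f \<in> borel_measurable borel"
    by (simp add: Psi[abs_def])
  define N where "N = (LINT t|lebesgue. cmod (f t / of_real (1 + \<bar>t\<bar>)))"
  have N: "0 \<le> N" unfolding N_def by (rule integral_nonneg_AE) auto
  have m: "(\<lambda>s. Psi f s / of_real ((1 + \<bar>s\<bar>) ^ 3)) \<in> borel_measurable lborel"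
    by measurable
  have int: "integrable lborel (\<lambda>s::real. 2 * N * (1 + \<bar>s\<bar>) powr (- 2))"
    by (intro integrable_mult_right integrable_one_plus_abs_powr) auto
  have cancel: "2 * w * N / w ^ 3 = 2 * N * (1 / w ^ 2)" if "0 < w" for w :: real
    using that by (simp add: power3_eq_cube power2_eq_square)
  have "cmod (Psi f s / of_real ((1 + \<bar>s\<bar>) ^ 3)) \<le> norm (2 * N * (1 + \<bar>s\<bar>) powr (- 2))" for s
  proof -
    have "cmod (Psi f s) \<le> (2 + \<bar>s\<bar>) * N" unfolding N_def by (rule Psi_norm_le[OF f])
    also have "\<dots> \<le> 2 * (1 + \<bar>s\<bar>) * N" using N by (intro mult_right_mono) auto
    finally have "cmod (Psi f s) / (1 + \<bar>s\<bar>) ^ 3 \<le> 2 * (1 + \<bar>s\<bar>) * N / (1 + \<bar>s\<bar>) ^ 3"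
      by (intro divide_right_mono) auto
    also have "\<dots> = 2 * N * (1 / (1 + \<bar>s\<bar>) ^ 2)"
      using cancel[of "1 + \<bar>s\<bar>"] by simp
    also have "\<dots> = 2 * N * (1 + \<bar>s\<bar>) powr (- 2)"
      by (simp add: powr_minus powr_numeral divide_simps)
    finally show ?thesis using N by (simp add: norm_divide abs_mult del: of_real_add of_real_power)
  qed
  then have "integrable lborel (\<lambda>s. Psi f s / of_real ((1 + \<bar>s\<bar>) ^ 3))"
    by (intro Bochner_Integration.integrable_bound[OF int m] AE_I2)
  then show ?thesis by (simp only: integrable_completion[OF m])
qed

text \<open>Integrating the double integrand over \<open>s\<close> first yields \<open>- f t * schwartz_fourier \<phi> t\<close> for
  \<open>t \<noteq> 0\<close>, by parts. Hence the integrability of \<open>f * schwartz_fourier \<phi>\<close> is the part of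
  Fubini's theorem saying that the inner integrals are integrable.\<close>

lemma Psi_fourier_identity:
  fixes f :: "real \<Rightarrow> complex"
  assumes f: "integrable lebesgue (\<lambda>t. f t / of_real (1 + \<bar>t\<bar>))" and \<phi>: "\<phi> \<in> schwartz"
  shows "integrable lebesgue (\<lambda>t. f t * schwartz_fourier \<phi> t)"
    and "- (LINT s|lebesgue. Psi f s * vector_derivative \<phi> (at s))
      = (LINT t|lebesgue. f t * schwartz_fourier \<phi> t)"
proof -
  let ?\<phi>' = "\<lambda>s. vector_derivative \<phi> (at s)"
  obtain g where g[measurable]: "g \<in> borel_measurable borel" and ae: "AE t in lebesgue. f t = g t"
    and int: "integrable lborel (\<lambda>t. g t / of_real (1 + \<bar>t\<bar>))"
    and Psi: "\<And>s. Psi f s = (LINT t|lborel. Psi_kernel s t * g t)"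
    using weighted_borel_representative[OF f] by blast
  note [measurable] = schwartz_borel[OF \<phi>] schwartz_borel[OF schwartz_deriv[OF \<phi>]]
  let ?H = "\<lambda>s t. Psi_kernel s t * g t * ?\<phi>' s"
  have H: "integrable (lborel \<Otimes>\<^sub>M lborel) (case_prod ?H)"
    by (rule Psi_kernel_pair_integrable[OF g int schwartz_deriv[OF \<phi>]])
  have inner: "(LINT s|lborel. ?H s t) = - (g t * schwartz_fourier \<phi> t)" if "t \<noteq> 0" for t
  proof -
    have "?H s t = g t * (Psi_kernel s t * ?\<phi>' s)" for s by (simp add: ac_simps)
    then have "(LINT s|lborel. ?H s t) = g t * (LINT s|lborel. Psi_kernel s t * ?\<phi>' s)"
      by (simp only: integral_mult_right_zero)
    then show ?thesis by (simp add: schwartz_fourier_eq_kernel_integral[OF \<phi> that])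
  qed
  have F: "schwartz_fourier \<phi> = (\<lambda>t. LINT s|lborel. exp (- \<i> * of_real s * of_real t) * \<phi> s)"
    unfolding schwartz_fourier_def by (intro ext integral_completion) measurable
  have Fm[measurable]: "schwartz_fourier \<phi> \<in> borel_measurable borel"
    unfolding F by measurable
  have gFm: "(\<lambda>t. g t * schwartz_fourier \<phi> t) \<in> borel_measurable lborel"
    by measurable
  have ne0: "AE t in lborel. t \<noteq> (0::real)" by (rule AE_lborel_singleton)
  have "integrable lborel (\<lambda>t. LINT s|lborel. ?H s t)"
    by (rule lborel_pair.integrable_snd[OF H])
  then have "integrable lborel (\<lambda>t. - (LINT s|lborel. ?H s t))" by simp
  then have gF: "integrable lborel (\<lambda>t. g t * schwartz_fourier \<phi> t)"
    by (rule integrable_cong_AE_imp[OF _ gFm]) (use ne0 inner in \<open>auto elim!: eventually_mono\<close>)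
  have fm: "f \<in> borel_measurable lebesgue" by (rule weighted_imp_lebesgue_measurable[OF f])
  have Fl: "schwartz_fourier \<phi> \<in> borel_measurable lebesgue"
    using Fm by (simp add: measurable_completion)
  have fFm: "(\<lambda>t. f t * schwartz_fourier \<phi> t) \<in> borel_measurable lebesgue"
    by (intro borel_measurable_times fm Fl)
  have ae': "AE t in lebesgue. g t * schwartz_fourier \<phi> t = f t * schwartz_fourier \<phi> t"
    using ae by (auto elim!: eventually_mono)
  show "integrable lebesgue (\<lambda>t. f t * schwartz_fourier \<phi> t)"
    using gF ae' by (intro integrable_cong_AE_imp[OF _ fFm ae']) (simp add: integrable_completion[OF gFm])
  have "(\<lambda>s. (LINT t|lborel. Psi_kernel s t * g t) * ?\<phi>' s) \<in> borel_measurable lborel"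
    unfolding Psi_kernel_def by measurable
  then have "(LINT s|lebesgue. Psi f s * ?\<phi>' s)
      = (LINT s|lborel. (LINT t|lborel. Psi_kernel s t * g t) * ?\<phi>' s)"
    unfolding Psi by (rule integral_completion)
  also have "\<dots> = (LINT s|lborel. LINT t|lborel. ?H s t)"
    by simp
  also have "\<dots> = (LINT t|lborel. LINT s|lborel. ?H s t)"
    by (rule lborel_pair.Fubini_integral[OF H, symmetric])
  also have "\<dots> = (LINT t|lborel. - (g t * schwartz_fourier \<phi> t))"
    by (rule integral_cong_AE)
      (use borel_measurable_integrable[OF lborel_pair.integrable_snd[OF H]] gFm ne0 inner
        in \<open>auto elim!: eventually_mono\<close>)
  also have "\<dots> = - (LINT t|lebesgue. g t * schwartz_fourier \<phi> t)"
    by (simp add: integral_completion[OF gFm])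
  also have "(LINT t|lebesgue. g t * schwartz_fourier \<phi> t) = (LINT t|lebesgue. f t * schwartz_fourier \<phi> t)"
    by (rule integral_cong_AE[OF measurable_completion[OF gFm] fFm ae'])
  finally show "- (LINT s|lebesgue. Psi f s * ?\<phi>' s) = (LINT t|lebesgue. f t * schwartz_fourier \<phi> t)"
    by simp
qed

theorem proposition5p1:
  fixes p :: "real \<Rightarrow> ennreal" and f :: "real \<Rightarrow> complex"
  assumes "p \<in> exponent_functions"
    and "ess_sup_exponent p < \<infinity> \<or> log_holder_at_infinity (reciprocal_exponent p) 1"
    and "f \<in> Lp_variable p"
  shows "(\<forall>s. integrable lebesgue (\<lambda>t. Psi_kernel s t * f t)) \<and>
    induces_tempered_distribution (Psi f) \<and>
    induces_tempered_distribution f \<and>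
    (\<forall>\<phi>\<in>schwartz.
       integrable lebesgue (\<lambda>s. Psi f s * vector_derivative \<phi> (at s)) \<and>
       integrable lebesgue (\<lambda>t. f t * schwartz_fourier \<phi> t) \<and>
       fourier_Lp f \<phi> = - (LINT s|lebesgue. Psi f s * vector_derivative \<phi> (at s)) \<and>
       - (LINT s|lebesgue. Psi f s * vector_derivative \<phi> (at s))
         = (LINT t|lebesgue. f t * schwartz_fourier \<phi> t) \<and>
       (LINT t|lebesgue. f t * schwartz_fourier \<phi> t)
         = tempered_fourier (regular_distribution f) \<phi>)"
proof -
  obtain R P where "1 < P" "AE x in lebesgue. R < \<bar>x\<bar> \<longrightarrow> p x \<le> ennreal P"
    using exponent_bounded_outside_interval[OF assms(1,2)] .
  then have f: "integrable lebesgue (\<lambda>t. f t / of_real (1 + \<bar>t\<bar>))"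
    using assms(1,3) by (intro Lp_variable_weighted_integrable)
  then have f1: "integrable lebesgue (\<lambda>t. f t / of_real ((1 + \<bar>t\<bar>) ^ 1))"
    by simp
  note Psi = Psi_weighted_integrable[OF f]
  show ?thesis
    using Psi_kernel_integrable[OF f] weighted_integrable_induces_tempered_distribution[OF Psi]
      weighted_integrable_induces_tempered_distribution[OF f1]
      weighted_integrable_schwartz_pairing[OF Psi schwartz_deriv] Psi_fourier_identity[OF f]
    unfolding fourier_Lp_def distribution_deriv_def regular_distribution_def
      iter_deriv_one tempered_fourier_def
    by auto
qed

end
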